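(* Consider the one-dimensional semi-discrete well-balanced central-upwind scheme defined in the context, $$\frac{d}{dt}\,\overline{\boldsymbol q}_k=-\frac{\boldsymbol{\mathcal G}_{k+\frac12}-\boldsymbol{\mathcal G}_{k-\frac12}}{\Delta y},\qquad k=k_\ell,\ldots,k_r,$$ with the well-balanced reconstruction and the numerical fluxes $\boldsymbol{\mathcal G}_{k+\frac12}=(\mathcal G^{(1)}_{k+\frac12},\mathcal G^{(2)}_{k+\frac12},\mathcal G^{(3)}_{k+\frac12})^\top$ given there. This scheme is well-balanced in the sense that it exactly preserves the steady state $v\equiv 0$, $L\equiv\mathrm{Const}$. That is, if at some time the discrete data satisfy $v_k=0$ and $L_k=\widehat L$ for all $k$ (including the ghost cells), where $\widehat L$ is a constant independent of $k$, then the right-hand side $-\frac{1}{\Delta y}\big(\boldsymbol{\mathcal G}_{k+\frac12}-\boldsymbol{\mathcal G}_{k-\frac12}\big)$ of the ODE system for $\overline{\boldsymbol q}_k$ is zero for every $k=k_\ell,\ldots,k_r$.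
   Context: **Continuous system.** The 1-D Euler equations with gravitation in conservative form are $\boldsymbol q_t+\boldsymbol G(\boldsymbol q)_y=\boldsymbol 0$ with $\boldsymbol q=(\rho,\rho v,E+\rho\phi)^\top$, $\boldsymbol G(\boldsymbol q)=(\rho v,\ \rho v^2+L,\ v(E+\rho\phi+p))^\top$, $p=(\gamma-1)(E-\frac12\rho v^2)$, $\gamma>1$. Here $\phi=\phi(y)$ is a given time-independent continuous potential with derivative $\phi_y$, and $L=p+R$, $R(y,t)=\int^y\rho(\eta,t)\phi_y(\eta)\,d\eta$. **Grid and data.** Uniform cells $C_k=[y_{k-\frac12},y_{k+\frac12}]$ of size $\Delta y>0$ and center $y_k$, $k=k_\ell,\ldots,k_r$. The unknowns are the cell averages $\overline{\boldsymbol q}_k=(\overline\rho_k,\overline{(\rho v)}_k,\overline{(E+\rho\phi)}_k)^\top$. Set $\overline E_k=\overline{(E+\rho\phi)}_k-\overline\rho_k\phi(y_k)$, $v_k=\overline{(\rho v)}_k/\overline\rho_k$, $p_k=(\gamma-1)(\overline E_k-\frac12\overline\rho_kv_k^2)$. Define $$R_{k_\ell-\frac12}=0,\quad R_{k+\frac12}=R_{k-\frac12}+\Delta y\,\overline\rho_k\,\phi_y(y_k),\quad R_k=\tfrac12(R_{k-\frac12}+R_{k+\frac12}),\quad L_k=p_k+R_k,\qquad k=k_\ell,\ldots,k_r.$$ Boundary conditions are imposed through ghost cells (two on each side, $k=k_\ell-2,k_\ell-1,k_r+1,k_r+2$), in which values $\overline\rho_k$, $v_k$, $L_k$ are prescribed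 and $\overline{(\rho v)}_k=\overline\rho_kv_k$. **Minmod function.** $\mathrm{minmod}(z_1,z_2,\ldots)$ equals $\min_i z_i$ if all $z_i>0$, $\max_i z_i$ if all $z_i<0$, and $0$ otherwise. For a grid function $w_k$, the generalized minmod slope is $$(w_y)_k=\mathrm{minmod}\Big(\theta\tfrac{w_{k+1}-w_k}{\Delta y},\tfrac{w_{k+1}-w_{k-1}}{2\Delta y},\theta\tfrac{w_k-w_{k-1}}{\Delta y}\Big),\quad \theta\in[1,2].$$ **Well-balanced reconstruction.** For $w\in\{\rho,\rho v,L\}$ (using $\overline\rho_k$, $\overline{(\rho v)}_k$, $L_k$ respectively as $w_k$), put $w_k^{\rm N}=w_k+\frac{\Delta y}2(w_y)_k$ and $w_k^{\rm S}=w_k-\frac{\Delta y}2(w_y)_k$. Then $v_k^{\rm N,S}=(\rho v)_k^{\rm N,S}/\rho_k^{\rm N,S}$, $p_k^{\rm N}=L_k^{\rm N}-R_{k+\frac12}$, $p_k^{\rm S}=L_k^{\rm S}-R_{k-\frac12}$, $E_k^{\rm N,S}=\frac{p_k^{\rm N,S}}{\gamma-1}+\frac12\rho_k^{\rm N,S}(v_k^{\rm N,S})^2$, $(\rho\phi)_k^{\rm N}=\rho_k^{\rm N}\phi(y_{k+\frac12})$, $(\rho\phi)_k^{\rm S}=\rho_k^{\rm S}\phi(y_{k-\frac12})$, $c_k^{\rm N,S}=\sqrt{\gamma p_k^{\rm N,S}/\rho_k^{\rm N,S}}$. Write $\boldsymbol q_k^{\rm N,S}=(\rho_k^{\rm N,S},(\rho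 v)_k^{\rm N,S},E_k^{\rm N,S}+(\rho\phi)_k^{\rm N,S})^\top$, and let $\boldsymbol G(\boldsymbol q_k^{\rm N,S})$ be $\boldsymbol G$ evaluated with these one-sided values (including $L_k^{\rm N,S}$, $p_k^{\rm N,S}$). **Local speeds.** $b^+_{k+\frac12}=\max(v_k^{\rm N}+c_k^{\rm N},v_{k+1}^{\rm S}+c_{k+1}^{\rm S},0)$, $b^-_{k+\frac12}=\min(v_k^{\rm N}-c_k^{\rm N},v_{k+1}^{\rm S}-c_{k+1}^{\rm S},0)$, $\beta_{k+\frac12}=\dfrac{b^+_{k+\frac12}b^-_{k+\frac12}}{b^+_{k+\frac12}-b^-_{k+\frac12}}$. **Anti-diffusion.** $\delta\boldsymbol q_{k+\frac12}=\mathrm{minmod}(\boldsymbol q_{k+1}^{\rm S}-\boldsymbol q^*_{k+\frac12},\ \boldsymbol q^*_{k+\frac12}-\boldsymbol q_k^{\rm N})$ (componentwise, components denoted $\delta\rho$, $\delta(\rho v)$, $\delta(E+\rho\phi)$), where $$\boldsymbol q^*_{k+\frac12}=\frac{b^+_{k+\frac12}\boldsymbol q_{k+1}^{\rm S}-b^-_{k+\frac12}\boldsymbol q_k^{\rm N}-(\boldsymbol G(\boldsymbol q_{k+1}^{\rm S})-\boldsymbol G(\boldsymbol q_k^{\rm N}))}{b^+_{k+\frac12}-b^-_{k+\frac12}}.$$ **Cut-off.** $H(\psi)=\dfrac{(C\psi)^m}{1+(C\psi)^m}$ with fixed $C>0$ and positive integer $m$ (e.g. $C=200$, $m=6$), and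 $$\psi_{k+\frac12}=\frac{|L_{k+1}-L_k|}{\Delta y}\cdot\frac{y_{k_r+\frac12}-y_{k_\ell-\frac12}}{\max\{L_k,L_{k+1}\}}.$$ **Numerical fluxes** (for $k=k_\ell-1,\ldots,k_r$; the subscript $k+\frac12$ on $b^\pm,\beta,\delta$ is omitted on the right-hand sides): $$\mathcal G^{(1)}_{k+\frac12}=\frac{b^+(\rho v)_k^{\rm N}-b^-(\rho v)_{k+1}^{\rm S}}{b^+-b^-}+\beta H(\psi_{k+\frac12})\,(\rho_{k+1}^{\rm S}-\rho_k^{\rm N}-\delta\rho),$$ $$\mathcal G^{(2)}_{k+\frac12}=\frac{b^+(\rho_k^{\rm N}(v_k^{\rm N})^2+L_k^{\rm N})-b^-(\rho_{k+1}^{\rm S}(v_{k+1}^{\rm S})^2+L_{k+1}^{\rm S})}{b^+-b^-}+\beta\big((\rho v)_{k+1}^{\rm S}-(\rho v)_k^{\rm N}-\delta(\rho v)\big),$$ $$\mathcal G^{(3)}_{k+\frac12}=\frac{b^+v_k^{\rm N}(E_k^{\rm N}+(\rho\phi)_k^{\rm N}+p_k^{\rm N})-b^-v_{k+1}^{\rm S}(E_{k+1}^{\rm S}+(\rho\phi)_{k+1}^{\rm S}+p_{k+1}^{\rm S})}{b^+-b^-}+\beta\Big[E_{k+1}^{\rm S}-E_k^{\rm N}+H(\psi_{k+\frac12})\big((\rho\phi)_{k+1}^{\rm S}-(\rho\phi)_k^{\rm N}-\delta(E+\rho\phi)\big)\Big].$$ **Standing assumption.** The data are such that all quantities are well defined: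 $\overline\rho_k$, $\rho_k^{\rm N,S}$ and $p_k^{\rm N,S}$ are positive wherever used, and the denominators $\max\{L_k,L_{k+1}\}$ are nonzero. *)

theory Defs
  imports "HOL-Analysis.Analysis"
begin

text \<open>
  Cells are indexed by integers. Since the only half-integer indices are interfaces, the interface
  \<open>k + 1/2\<close> is represented by the integer \<open>k\<close>: an interface quantity \<open>f k\<close> stands for
  \<open>f\<close> at \<open>k + 1/2\<close>, and \<open>f (k - 1)\<close> for \<open>f\<close> at \<open>k - 1/2\<close>.
\<close>

text \<open>
  \<open>y_left\<close> is the left end of the domain, i.e. the interface \<open>kl - 1/2\<close>; \<open>cut_C\<close> and \<open>cut_m\<close>
  are the constants of the cut-off function \<open>H\<close>.
\<close>

record scheme =
  kl :: int
  kr :: int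
  y_left :: real
  \<Delta>y :: real
  \<gamma> :: real
  \<theta> :: real
  cut_C :: real
  cut_m :: nat
  \<phi> :: "real \<Rightarrow> real"
  \<phi>\<^sub>y :: "real \<Rightarrow> real"

text \<open>
  The discrete data at one instant: \<open>avg\<close> holds the averages of \<open>(\<rho>, \<rho>v, E + \<rho>\<phi>)\<close> and is only read
  for \<open>kl \<le> k \<le> kr\<close>; the prescribed ghost values are only read for the two indices on
  either side of this range.
\<close>

record cell_data =
  avg :: "int \<Rightarrow> real^3"
  ghost_rho :: "int \<Rightarrow> real"
  ghost_v :: "int \<Rightarrow> real"
  ghost_L :: "int \<Rightarrow> real"

definition yface :: "scheme \<Rightarrow> int \<Rightarrow> real" where
  "yface P k = y_left P + \<Delta>y P * of_int (k - kl P + 1)"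

definition ycenter :: "scheme \<Rightarrow> int \<Rightarrow> real" where
  "ycenter P k = (yface P (k - 1) + yface P k) / 2"

definition grid_domain :: "scheme \<Rightarrow> real set" where
  "grid_domain P = {yface P (kl P - 1)..yface P (kr P)}"

definition interior_cell :: "scheme \<Rightarrow> int \<Rightarrow> bool" where
  "interior_cell P k \<longleftrightarrow> kl P \<le> k \<and> k \<le> kr P"

definition rho :: "scheme \<Rightarrow> cell_data \<Rightarrow> int \<Rightarrow> real" where
  "rho P D k = (if interior_cell P k then avg D k $ 1 else ghost_rho D k)"

definition vel :: "scheme \<Rightarrow> cell_data \<Rightarrow> int \<Rightarrow> real" where
  "vel P D k = (if interior_cell P k then avg D k $ 2 / avg D k $ 1 else ghost_v D k)"

definition mom :: "scheme \<Rightarrow> cell_data \<Rightarrow> int \<Rightarrow> real" where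
  "mom P D k = (if interior_cell P k then avg D k $ 2 else ghost_rho D k * ghost_v D k)"

definition energy :: "scheme \<Rightarrow> cell_data \<Rightarrow> int \<Rightarrow> real" where
  "energy P D k = avg D k $ 3 - rho P D k * \<phi> P (ycenter P k)"

definition pres :: "scheme \<Rightarrow> cell_data \<Rightarrow> int \<Rightarrow> real" where
  "pres P D k = (\<gamma> P - 1) * (energy P D k - rho P D k * (vel P D k)\<^sup>2 / 2)"

function Rface :: "scheme \<Rightarrow> cell_data \<Rightarrow> int \<Rightarrow> real" where
  "Rface P D k = (if k < kl P then 0
     else Rface P D (k - 1) + \<Delta>y P * rho P D k * \<phi>\<^sub>y P (ycenter P k))"
  by pat_completeness auto
termination
  by (relation "Wellfounded.measure (\<lambda>(P, D, k). nat (k - kl P + 1))") auto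

declare Rface.simps [simp del]

definition Rcell :: "scheme \<Rightarrow> cell_data \<Rightarrow> int \<Rightarrow> real" where
  "Rcell P D k = (Rface P D (k - 1) + Rface P D k) / 2"

definition Lcell :: "scheme \<Rightarrow> cell_data \<Rightarrow> int \<Rightarrow> real" where
  "Lcell P D k = (if interior_cell P k then pres P D k + Rcell P D k else ghost_L D k)"

definition minmod :: "real list \<Rightarrow> real" where
  "minmod zs = (if \<forall>z\<in>set zs. z > 0 then Min (set zs)
                else if \<forall>z\<in>set zs. z < 0 then Max (set zs) else 0)"

definition slope :: "scheme \<Rightarrow> (int \<Rightarrow> real) \<Rightarrow> int \<Rightarrow> real" where
  "slope P w k = minmod
     [\<theta> P * ((w (k + 1) - w k) / \<Delta>y P),
      (w (k + 1) - w (k - 1)) / (2 * \<Delta>y P),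
      \<theta> P * ((w k - w (k - 1)) / \<Delta>y P)]"

text \<open>
  The one-sided values in cell \<open>k\<close>: \<open>North\<close> is the value at the interface \<open>k + 1/2\<close>, \<open>South\<close> the
  one at \<open>k - 1/2\<close>.
\<close>

datatype side = North | South

fun iface :: "side \<Rightarrow> int \<Rightarrow> int" where
  "iface North k = k"
| "iface South k = k - 1"

fun recon :: "scheme \<Rightarrow> (int \<Rightarrow> real) \<Rightarrow> side \<Rightarrow> int \<Rightarrow> real" where
  "recon P w North k = w k + \<Delta>y P / 2 * slope P w k"
| "recon P w South k = w k - \<Delta>y P / 2 * slope P w k"

definition rho1 :: "scheme \<Rightarrow> cell_data \<Rightarrow> side \<Rightarrow> int \<Rightarrow> real" where
  "rho1 P D s k = recon P (rho P D) s k"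

definition mom1 :: "scheme \<Rightarrow> cell_data \<Rightarrow> side \<Rightarrow> int \<Rightarrow> real" where
  "mom1 P D s k = recon P (mom P D) s k"

definition L1 :: "scheme \<Rightarrow> cell_data \<Rightarrow> side \<Rightarrow> int \<Rightarrow> real" where
  "L1 P D s k = recon P (Lcell P D) s k"

definition vel1 :: "scheme \<Rightarrow> cell_data \<Rightarrow> side \<Rightarrow> int \<Rightarrow> real" where
  "vel1 P D s k = mom1 P D s k / rho1 P D s k"

definition pres1 :: "scheme \<Rightarrow> cell_data \<Rightarrow> side \<Rightarrow> int \<Rightarrow> real" where
  "pres1 P D s k = L1 P D s k - Rface P D (iface s k)"

definition energy1 :: "scheme \<Rightarrow> cell_data \<Rightarrow> side \<Rightarrow> int \<Rightarrow> real" where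
  "energy1 P D s k = pres1 P D s k / (\<gamma> P - 1) + rho1 P D s k * (vel1 P D s k)\<^sup>2 / 2"

definition rhophi1 :: "scheme \<Rightarrow> cell_data \<Rightarrow> side \<Rightarrow> int \<Rightarrow> real" where
  "rhophi1 P D s k = rho1 P D s k * \<phi> P (yface P (iface s k))"

definition sound1 :: "scheme \<Rightarrow> cell_data \<Rightarrow> side \<Rightarrow> int \<Rightarrow> real" where
  "sound1 P D s k = sqrt (\<gamma> P * pres1 P D s k / rho1 P D s k)"

definition q1 :: "scheme \<Rightarrow> cell_data \<Rightarrow> side \<Rightarrow> int \<Rightarrow> real^3" where
  "q1 P D s k = vector [rho1 P D s k, mom1 P D s k, energy1 P D s k + rhophi1 P D s k]"

text \<open>The physical flux \<open>G\<close>, evaluated at the one-sided values (including those of \<open>L\<close> and \<open>p\<close>).\<close>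

definition G1 :: "scheme \<Rightarrow> cell_data \<Rightarrow> side \<Rightarrow> int \<Rightarrow> real^3" where
  "G1 P D s k = vector
     [mom1 P D s k,
      rho1 P D s k * (vel1 P D s k)\<^sup>2 + L1 P D s k,
      vel1 P D s k * (energy1 P D s k + rhophi1 P D s k + pres1 P D s k)]"

definition bplus :: "scheme \<Rightarrow> cell_data \<Rightarrow> int \<Rightarrow> real" where
  "bplus P D k = Max {vel1 P D North k + sound1 P D North k,
                      vel1 P D South (k + 1) + sound1 P D South (k + 1), 0}"

definition bminus :: "scheme \<Rightarrow> cell_data \<Rightarrow> int \<Rightarrow> real" where
  "bminus P D k = Min {vel1 P D North k - sound1 P D North k,
                       vel1 P D South (k + 1) - sound1 P D South (k + 1), 0}"

definition beta :: "scheme \<Rightarrow> cell_data \<Rightarrow> int \<Rightarrow> real" where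
  "beta P D k = bplus P D k * bminus P D k / (bplus P D k - bminus P D k)"

definition qstar :: "scheme \<Rightarrow> cell_data \<Rightarrow> int \<Rightarrow> real^3" where
  "qstar P D k = (1 / (bplus P D k - bminus P D k)) *\<^sub>R
     (bplus P D k *\<^sub>R q1 P D South (k + 1) - bminus P D k *\<^sub>R q1 P D North k
      - (G1 P D South (k + 1) - G1 P D North k))"

definition delta_q :: "scheme \<Rightarrow> cell_data \<Rightarrow> int \<Rightarrow> real^3" where
  "delta_q P D k = (\<chi> i. minmod
     [(q1 P D South (k + 1) - qstar P D k) $ i, (qstar P D k - q1 P D North k) $ i])"

definition cutoff :: "scheme \<Rightarrow> real \<Rightarrow> real" where
  "cutoff P x = (cut_C P * x) ^ cut_m P / (1 + (cut_C P * x) ^ cut_m P)"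

definition psi :: "scheme \<Rightarrow> cell_data \<Rightarrow> int \<Rightarrow> real" where
  "psi P D k = \<bar>Lcell P D (k + 1) - Lcell P D k\<bar> / \<Delta>y P
     * ((yface P (kr P) - yface P (kl P - 1)) / max (Lcell P D k) (Lcell P D (k + 1)))"

definition num_flux :: "scheme \<Rightarrow> cell_data \<Rightarrow> int \<Rightarrow> real^3" where
  "num_flux P D k =
    (let bp = bplus P D k; bm = bminus P D k; \<beta> = beta P D k; \<delta> = delta_q P D k;
         H = cutoff P (psi P D k)
     in vector
      [(bp * mom1 P D North k - bm * mom1 P D South (k + 1)) / (bp - bm)
         + \<beta> * H * (rho1 P D South (k + 1) - rho1 P D North k - \<delta> $ 1),
       (bp * (rho1 P D North k * (vel1 P D North k)\<^sup>2 + L1 P D North k)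
          - bm * (rho1 P D South (k + 1) * (vel1 P D South (k + 1))\<^sup>2 + L1 P D South (k + 1)))
         / (bp - bm)
         + \<beta> * (mom1 P D South (k + 1) - mom1 P D North k - \<delta> $ 2),
       (bp * vel1 P D North k
             * (energy1 P D North k + rhophi1 P D North k + pres1 P D North k)
          - bm * vel1 P D South (k + 1)
             * (energy1 P D South (k + 1) + rhophi1 P D South (k + 1) + pres1 P D South (k + 1)))
         / (bp - bm)
         + \<beta> * (energy1 P D South (k + 1) - energy1 P D North k
              + H * (rhophi1 P D South (k + 1) - rhophi1 P D North k - \<delta> $ 3))])"

text \<open>The semi-discrete scheme is the ODE system \<open>d/dt (avg D k) = scheme_rhs P D k\<close>, \<open>kl \<le> k \<le> kr\<close>.\<close>

definition scheme_rhs :: "scheme \<Rightarrow> cell_data \<Rightarrow> int \<Rightarrow> real^3" where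
  "scheme_rhs P D k = - ((1 / \<Delta>y P) *\<^sub>R (num_flux P D k - num_flux P D (k - 1)))"

end

theory Submission imports Defs begin

text \<open>
  At rest with \<open>L\<close> constant, every minmod slope of \<open>\<rho>v\<close> and \<open>L\<close> vanishes, so the one-sided
  velocities are zero and the one-sided values of \<open>L\<close> equal the constant. Both sides of an interface
  subtract the same \<open>R\<close>, so pressure and energy are continuous there, while the cut-off \<open>H\<close> removes
  the jumps of \<open>\<rho>\<close> and \<open>\<rho>\<phi>\<close>. Hence every numerical flux equals \<open>(0, L, 0)\<close>.
\<close>

lemma minmod_zero: "0 \<in> set zs \<Longrightarrow> minmod zs = 0"
  by (auto simp: minmod_def)

lemma recon_locally_constant:
  assumes "w (k + 1) = c" "w k = c" "w (k - 1) = c"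
  shows "recon P w s k = c"
  using assms by (cases s) (simp_all add: slope_def minmod_zero)

text \<open>Positivity matters in interior cells: as \<open>x / 0 = 0\<close>, a zero quotient alone
  would not force zero momentum.\<close>

lemma mom_zero:
  assumes "rho P D k > 0" "vel P D k = 0"
  shows "mom P D k = 0"
  using assms by (auto simp: rho_def vel_def mom_def split: if_splits)

lemma num_flux_at_rest:
  assumes "\<gamma> P > 0" "cut_m P > 0"
    and north_pos: "rho1 P D North k > 0" "pres1 P D North k > 0"
    and mom: "mom1 P D North k = 0" "mom1 P D South (k + 1) = 0"
    and L: "L1 P D North k = c" "L1 P D South (k + 1) = c"
    and Lcell: "Lcell P D (k + 1) = Lcell P D k"
  shows "num_flux P D k = vector [0, c, 0]"
proof -
  have vel: "vel1 P D North k = 0" "vel1 P D South (k + 1) = 0"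
    by (simp_all add: vel1_def mom)
  have "energy1 P D South (k + 1) = energy1 P D North k"
    by (simp add: energy1_def pres1_def L vel)
  \<comment> \<open>With exponent 0 the cut-off would be 1/2, since
    \<open>0 ^ 0 = 1\<close>.\<close>
  moreover have "cutoff P (psi P D k) = 0"
    using \<open>cut_m P > 0\<close> by (simp add: cutoff_def psi_def Lcell)
  \<comment> \<open>A positive sound speed on one side already makes \<open>bplus - bminus\<close>
    nonzero, so it cancels.\<close>
  moreover have "sound1 P D North k > 0"
    using \<open>\<gamma> P > 0\<close> north_pos by (simp add: sound1_def)
  then have "bplus P D k > 0" "bminus P D k \<le> 0"
    by (simp_all add: bplus_def bminus_def vel less_max_iff_disj)
  then have "(bplus P D k * c - bminus P D k * c) / (bplus P D k - bminus P D k) = c"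
    by (simp flip: left_diff_distrib)
  \<comment> \<open>The momentum flux has no factor H, so its anti-diffusion must vanish by
    itself.\<close>
  moreover have "qstar P D k $ 2 = 0"
    by (simp add: qstar_def q1_def G1_def mom L vel vector_3)
  then have "delta_q P D k $ 2 = 0"
    by (simp add: delta_q_def q1_def mom vector_3 minmod_zero)
  ultimately show ?thesis
    by (simp add: num_flux_def Let_def mom L vel)
qed

theorem theorem2p1:
  fixes P :: scheme and D :: cell_data and Lhat :: real
  assumes "kl P \<le> kr P" and "\<Delta>y P > 0" and "\<gamma> P > 1"
    and "1 \<le> \<theta> P" and "\<theta> P \<le> 2"
    and "cut_C P > 0" and "cut_m P > 0"
    and potential: "\<forall>y\<in>grid_domain P. (\<phi> P has_real_derivative \<phi>\<^sub>y P y) (at y within grid_domain P)"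
    and rho_pos: "\<forall>k\<in>{kl P - 2..kr P + 2}. rho P D k > 0"
    and north_pos: "\<forall>k\<in>{kl P - 1..kr P}. rho1 P D North k > 0 \<and> pres1 P D North k > 0"
    and south_pos: "\<forall>k\<in>{kl P..kr P + 1}. rho1 P D South k > 0 \<and> pres1 P D South k > 0"
    and max_nonzero: "\<forall>k\<in>{kl P - 1..kr P}. max (Lcell P D k) (Lcell P D (k + 1)) \<noteq> 0"
    and steady: "\<forall>k\<in>{kl P - 2..kr P + 2}. vel P D k = 0 \<and> Lcell P D k = Lhat"
  shows "\<forall>k\<in>{kl P..kr P}. scheme_rhs P D k = 0"
proof -
  \<comment> \<open>The fluxes read one ghost cell per side; its slope reads the second.\<close>
  have rest: "mom1 P D s j = 0 \<and> L1 P D s j = Lhat" if "j \<in> {kl P - 1..kr P + 1}" for s j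
  proof -
    have "mom P D i = 0 \<and> Lcell P D i = Lhat" if "i \<in> {kl P - 2..kr P + 2}" for i
      using that rho_pos steady by (auto intro: mom_zero)
    then show ?thesis
      using that unfolding mom1_def L1_def by (auto intro!: recon_locally_constant)
  qed
  have "num_flux P D k = vector [0, Lhat, 0]" if "k \<in> {kl P - 1..kr P}" for k
    using that assms(3,7) north_pos steady rest[of k] rest[of "k + 1"]
    by (intro num_flux_at_rest) auto
  then show ?thesis
    by (auto simp: scheme_rhs_def)
qed

end
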